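(* Let $T$ be a $p$-continuous linear operator between lattice-normed spaces $(X,p,E)$ and $(Y,m,F)$. Then $T$ is $p$-bounded.
   Context: All vector lattices are real and Archimedean. A net $(x_\alpha)$ in a vector lattice $X$ order converges to $x$ (written $x_\alpha\xrightarrow{o}x$) if there is a net $(y_\beta)_{\beta\in B}$ (possibly with a different index set) with $y_\beta\downarrow 0$ such that for every $\beta$ there is $\alpha_\beta$ with $|x_\alpha-x|\le y_\beta$ for all $\alpha\ge\alpha_\beta$. A lattice-normed space is a triple $(X,p,E)$ with $X$ a real vector space, $E$ a vector lattice and $p:X\to E_+$ such that $p(x)=0\Leftrightarrow x=0$, $p(\lambda x)=|\lambda|p(x)$, $p(x+y)\le p(x)+p(y)$. A net $x_\alpha$ $p$-converges to $x$ (written $x_\alpha\xrightarrow{p}x$) if $p(x_\alpha-x)\xrightarrow{o}0$ in $E$. A subset $A\subseteq X$ is $p$-bounded if there is $e\in E$ with $p(a)\le e$ for all $a\in A$. A linear operator $T:(X,p,E)\to(Y,m,F)$ is $p$-continuous if for every net, $x_\alpha\xrightarrow{p}0$ in $X$ implies $Tx_\alpha\xrightarrow{p}0$ in $Y$; it is $p$-bounded if it maps $p$-bounded sets to $p$-bounded sets. *)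

theory Defs
  imports Complex_Main "HOL-Library.Lattice_Algebras"
begin

text \<open>\<open>archimedean\<close> says that \<open>inf {x / n | n \<ge> 1} = 0\<close> for every \<open>x \<ge> 0\<close>.\<close>

class archimedean_vector_lattice = ordered_real_vector + lattice_ab_group_add_abs +
  assumes archimedean:
    "0 \<le> x \<Longrightarrow> (\<And>n::nat. y \<le> (1 / real (Suc n)) *\<^sub>R x) \<Longrightarrow> y \<le> 0"

text \<open>A net is a function \<open>x\<close> considered on a directed index set \<open>A\<close>, whose preorder is
  given as a relation: \<open>(a, b) \<in> r\<close> means \<open>a \<le> b\<close>.\<close>

definition directed_set :: "'i set \<Rightarrow> 'i rel \<Rightarrow> bool" where
  "directed_set A r \<longleftrightarrow>
     A \<noteq> {} \<and> preorder_on A r \<and> (\<forall>a\<in>A. \<forall>b\<in>A. \<exists>c\<in>A. (a, c) \<in> r \<and> (b, c) \<in> r)"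

definition decreases_to :: "'i set \<Rightarrow> 'i rel \<Rightarrow> ('i \<Rightarrow> 'e::order) \<Rightarrow> 'e \<Rightarrow> bool" where
  "decreases_to B s y l \<longleftrightarrow>
     directed_set B s \<and> (\<forall>(b, c)\<in>s. y c \<le> y b) \<and>
     (\<forall>b\<in>B. l \<le> y b) \<and> (\<forall>z. (\<forall>b\<in>B. z \<le> y b) \<longrightarrow> z \<le> l)"

definition order_dominated ::
  "'b set \<Rightarrow> 'b rel \<Rightarrow> ('b \<Rightarrow> 'e) \<Rightarrow> 'i set \<Rightarrow> 'i rel \<Rightarrow> ('i \<Rightarrow> 'e) \<Rightarrow> 'e::archimedean_vector_lattice \<Rightarrow> bool"
  where
  "order_dominated B s y A r x l \<longleftrightarrow>
     decreases_to B s y 0 \<and>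
     (\<forall>\<beta>\<in>B. \<exists>\<alpha>\<in>A. \<forall>\<alpha>'\<in>A. (\<alpha>, \<alpha>') \<in> r \<longrightarrow> \<bar>x \<alpha>' - l\<bar> \<le> y \<beta>)"

text \<open>A formula cannot quantify over the type of the index set of the dominating net \<open>y\<close>.
  Taking the indices of \<open>y\<close> in the type of the lattice itself loses nothing:
  see \<open>order_convergesI\<close> below.\<close>

definition order_converges ::
  "'i set \<Rightarrow> 'i rel \<Rightarrow> ('i \<Rightarrow> 'e) \<Rightarrow> 'e::archimedean_vector_lattice \<Rightarrow> bool" where
  "order_converges A r x l \<longleftrightarrow>
     (\<exists>(B :: 'e set) s y. order_dominated B s y A r x l)"

lemma order_convergesI:
  fixes B :: "'b set" and y :: "'b \<Rightarrow> 'e::archimedean_vector_lattice"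
  assumes "order_dominated B s y A r x l"
  shows "order_converges A r x l"
proof -
  let ?s = "{(u, v). u \<in> y ` B \<and> v \<in> y ` B \<and> v \<le> u}"
  have d: "directed_set B s" and anti: "\<And>b c. (b, c) \<in> s \<Longrightarrow> y c \<le> y b"
    using assms by (auto simp: order_dominated_def decreases_to_def)
  have "\<exists>w\<in>y ` B. (u, w) \<in> ?s \<and> (v, w) \<in> ?s" if uv: "u \<in> y ` B" "v \<in> y ` B" for u v
  proof -
    from uv obtain a b where ab: "a \<in> B" "b \<in> B" "u = y a" "v = y b" by auto
    with d obtain c where c: "c \<in> B" "(a, c) \<in> s" "(b, c) \<in> s"
      unfolding directed_set_def by metis
    then have "y c \<le> u" "y c \<le> v" using anti ab by auto
    then show ?thesis using c uv by blast
  qed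
  moreover have "preorder_on (y ` B) ?s"
    by (auto simp: preorder_on_def refl_on_def trans_def)
  ultimately have "directed_set (y ` B) ?s"
    using d unfolding directed_set_def by blast
  then have "order_dominated (y ` B) ?s (\<lambda>u. u) A r x l"
    using assms by (auto simp: order_dominated_def decreases_to_def)
  then show ?thesis unfolding order_converges_def by blast
qed

locale lattice_normed_space =
  fixes p :: "'x::real_vector \<Rightarrow> 'e::archimedean_vector_lattice"
  assumes p_nonneg: "0 \<le> p x"
    and p_eq_0_iff: "p x = 0 \<longleftrightarrow> x = 0"
    and p_scaleR: "p (c *\<^sub>R x) = \<bar>c\<bar> *\<^sub>R p x"
    and p_triangle: "p (x + y) \<le> p x + p y"

definition p_converges ::
  "('x::real_vector \<Rightarrow> 'e::archimedean_vector_lattice) \<Rightarrow> 'i set \<Rightarrow> 'i rel \<Rightarrow> ('i \<Rightarrow> 'x) \<Rightarrow> 'x \<Rightarrow> bool"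
  where "p_converges p A r x l \<longleftrightarrow> order_converges A r (\<lambda>\<alpha>. p (x \<alpha> - l)) 0"

text \<open>Again the type of index sets has to be fixed. Pairs of a point of \<open>X\<close> and a subset of \<open>X\<close>
  are enough indices to cover all nets in \<open>X\<close>, with index sets of any type:
  see \<open>p_continuousD\<close> below, where a net is replaced by the net of pairs
  (point, tail of the net containing it).\<close>

definition p_continuous ::
  "('x::real_vector \<Rightarrow> 'e::archimedean_vector_lattice) \<Rightarrow>
   ('y::real_vector \<Rightarrow> 'f::archimedean_vector_lattice) \<Rightarrow> ('x \<Rightarrow> 'y) \<Rightarrow> bool" where
  "p_continuous p m T \<longleftrightarrow>
     (\<forall>(A :: ('x \<times> 'x set) set) r x. directed_set A r \<longrightarrow>
        p_converges p A r x 0 \<longrightarrow> p_converges m A r (\<lambda>\<alpha>. T (x \<alpha>)) 0)"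

lemma p_continuousD:
  fixes A :: "'i set" and x :: "'i \<Rightarrow> 'x::real_vector"
    and p :: "'x \<Rightarrow> 'e::archimedean_vector_lattice"
    and m :: "'y::real_vector \<Rightarrow> 'f::archimedean_vector_lattice"
  assumes T: "p_continuous p m T" and A: "directed_set A r" and x: "p_converges p A r x 0"
  shows "p_converges m A r (\<lambda>\<alpha>. T (x \<alpha>)) 0"
proof -
  define tail where "tail a = x ` {b \<in> A. (a, b) \<in> r}" for a
  define A' where "A' = {(v, S). \<exists>a\<in>A. S = tail a \<and> v \<in> S}"
  define r' where "r' = {(i, j). i \<in> A' \<and> j \<in> A' \<and> snd j \<subseteq> snd i}"
  have refl: "(a, a) \<in> r" if "a \<in> A" for a
    using A that by (auto simp: directed_set_def preorder_on_def refl_on_def)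
  have tr: "(a, c) \<in> r" if "(a, b) \<in> r" "(b, c) \<in> r" for a b c
    using A that by (auto simp: directed_set_def preorder_on_def dest: transD)
  have tail_mono: "tail b \<subseteq> tail a" if "(a, b) \<in> r" for a b
    using tr that by (auto simp: tail_def)
  have in_A': "(x b, tail a) \<in> A'" if "a \<in> A" "b \<in> A" "(a, b) \<in> r" for a b
    using that by (auto simp: A'_def tail_def)
  have A': "directed_set A' r'"
    unfolding directed_set_def
  proof (intro conjI ballI)
    show "A' \<noteq> {}" using A in_A' refl by (force simp: directed_set_def)
    show "preorder_on A' r'"
      by (auto simp: preorder_on_def refl_on_def trans_def r'_def)
    fix i j assume ij: "i \<in> A'" "j \<in> A'"
    then obtain a b where ab: "a \<in> A" "b \<in> A" "snd i = tail a" "snd j = tail b"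
      by (auto simp: A'_def)
    with A obtain c where c: "c \<in> A" "(a, c) \<in> r" "(b, c) \<in> r"
      unfolding directed_set_def by blast
    then have "(i, (x c, tail c)) \<in> r'" "(j, (x c, tail c)) \<in> r'"
      using ij ab tail_mono in_A' refl by (auto simp: r'_def)
    then show "\<exists>k\<in>A'. (i, k) \<in> r' \<and> (j, k) \<in> r'"
      using c in_A' refl by blast
  qed
  have "p_converges p A' r' fst 0"
  proof -
    obtain B :: "'e set" and s y where y: "order_dominated B s y A r (\<lambda>\<alpha>. p (x \<alpha> - 0)) 0"
      using x unfolding p_converges_def order_converges_def by blast
    have "\<exists>i\<in>A'. \<forall>j\<in>A'. (i, j) \<in> r' \<longrightarrow> \<bar>p (fst j - 0) - 0\<bar> \<le> y \<beta>" if "\<beta> \<in> B" for \<beta>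
    proof -
      have "\<exists>a\<in>A. \<forall>b\<in>A. (a, b) \<in> r \<longrightarrow> \<bar>p (x b - 0) - 0\<bar> \<le> y \<beta>"
        using y that by (simp add: order_dominated_def)
      then obtain a where a: "a \<in> A" "\<And>b. b \<in> A \<Longrightarrow> (a, b) \<in> r \<Longrightarrow> \<bar>p (x b - 0) - 0\<bar> \<le> y \<beta>"
        by blast
      have "\<bar>p (fst j - 0) - 0\<bar> \<le> y \<beta>" if "j \<in> A'" "((x a, tail a), j) \<in> r'" for j
      proof -
        have "fst j \<in> tail a" using that by (auto simp: A'_def r'_def)
        then obtain b where "b \<in> A" "(a, b) \<in> r" "fst j = x b" by (auto simp: tail_def)
        then show ?thesis using a by simp
      qed
      moreover have "(x a, tail a) \<in> A'" using in_A' refl a(1) by simp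
      ultimately show ?thesis by blast
    qed
    then have "order_dominated B s y A' r' (\<lambda>i. p (fst i - 0)) 0"
      using y by (simp add: order_dominated_def)
    then show ?thesis unfolding p_converges_def by (rule order_convergesI)
  qed
  then have "p_converges m A' r' (\<lambda>i. T (fst i)) 0"
    using T A' unfolding p_continuous_def by blast
  then obtain B :: "'f set" and s y where y: "order_dominated B s y A' r' (\<lambda>i. m (T (fst i) - 0)) 0"
    unfolding p_converges_def order_converges_def by blast
  have "\<exists>a\<in>A. \<forall>b\<in>A. (a, b) \<in> r \<longrightarrow> \<bar>m (T (x b) - 0) - 0\<bar> \<le> y \<beta>" if "\<beta> \<in> B" for \<beta>
  proof -
    have "\<exists>i\<in>A'. \<forall>j\<in>A'. (i, j) \<in> r' \<longrightarrow> \<bar>m (T (fst j) - 0) - 0\<bar> \<le> y \<beta>"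
      using y that by (simp add: order_dominated_def)
    then obtain i where i: "i \<in> A'" "\<And>j. j \<in> A' \<Longrightarrow> (i, j) \<in> r' \<Longrightarrow> \<bar>m (T (fst j) - 0) - 0\<bar> \<le> y \<beta>"
      by blast
    obtain a where a: "a \<in> A" "snd i = tail a" using i(1) by (auto simp: A'_def)
    have "\<bar>m (T (x b) - 0) - 0\<bar> \<le> y \<beta>" if b: "b \<in> A" "(a, b) \<in> r" for b
    proof -
      have "(x b, tail b) \<in> A'" using b in_A' refl by blast
      moreover from \<open>(x b, tail b) \<in> A'\<close> have "(i, (x b, tail b)) \<in> r'"
        using i(1) a tail_mono[OF b(2)] by (auto simp: r'_def)
      ultimately show ?thesis using i(2)[of "(x b, tail b)"] by simp
    qed
    then show ?thesis using a(1) by blast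
  qed
  then have "order_dominated B s y A r (\<lambda>\<alpha>. m (T (x \<alpha>) - 0)) 0"
    using y by (simp add: order_dominated_def)
  then show ?thesis unfolding p_converges_def by (rule order_convergesI)
qed

definition p_bounded_set ::
  "('x::real_vector \<Rightarrow> 'e::archimedean_vector_lattice) \<Rightarrow> 'x set \<Rightarrow> bool" where
  "p_bounded_set p A \<longleftrightarrow> (\<exists>e. \<forall>a\<in>A. p a \<le> e)"

definition p_bounded ::
  "('x::real_vector \<Rightarrow> 'e::archimedean_vector_lattice) \<Rightarrow>
   ('y::real_vector \<Rightarrow> 'f::archimedean_vector_lattice) \<Rightarrow> ('x \<Rightarrow> 'y) \<Rightarrow> bool" where
  "p_bounded p m T \<longleftrightarrow> (\<forall>A. p_bounded_set p A \<longrightarrow> p_bounded_set m (T ` A))"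

end

theory Submission
  imports Defs
begin

text \<open>If \<open>p a \<le> e\<close> on \<open>A\<close>, the net \<open>(1 / (n + 1)) a\<close> indexed by the pairs \<open>(n, a)\<close> with
  \<open>a \<in> A\<close>, preordered by \<open>n\<close> alone, \<open>p\<close>-converges to \<open>0\<close>. Its image under \<open>T\<close> therefore
  has a \<open>p\<close>-bounded tail; such a tail contains \<open>(1 / (n + 1)) T a\<close> for all \<open>a \<in> A\<close> and one common
  \<open>n\<close>.\<close>

lemma decreases_to_inverse_Suc:
  fixes e :: "'e::archimedean_vector_lattice"
  assumes "0 \<le> e"
  shows "decreases_to UNIV {(m, n). m \<le> n} (\<lambda>n. (1 / real (Suc n)) *\<^sub>R e) 0"
proof -
  have "directed_set UNIV {(m, n :: nat). m \<le> n}"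
    by (auto simp: directed_set_def preorder_on_def refl_on_def trans_def
        intro: max.cobounded1 max.cobounded2)
  moreover have "(1 / real (Suc n)) *\<^sub>R e \<le> (1 / real (Suc m)) *\<^sub>R e" if "m \<le> n" for m n
    using assms that by (intro scaleR_right_mono) (auto simp: frac_le)
  \<comment> \<open>That nothing above \<open>0\<close> bounds the whole sequence from below is
    precisely the Archimedean axiom.\<close>
  moreover have "z \<le> 0" if "\<And>n. z \<le> (1 / real (Suc n)) *\<^sub>R e" for z
    using archimedean[OF assms that] .
  moreover have "0 \<le> (1 / real (Suc n)) *\<^sub>R e" for n
    using assms by (intro scaleR_nonneg_nonneg) auto
  ultimately show ?thesis
    unfolding decreases_to_def by auto
qed

text \<open>The index set of the dominating net is directed, hence nonempty, so any single member of
  that net can serve as the bound \<open>b\<close> on a tail.\<close>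

lemma order_converges_eventually_bounded:
  assumes "order_converges A r x l"
  obtains \<alpha> b where "\<alpha> \<in> A" "\<And>\<alpha>'. \<alpha>' \<in> A \<Longrightarrow> (\<alpha>, \<alpha>') \<in> r \<Longrightarrow> \<bar>x \<alpha>' - l\<bar> \<le> b"
  using assms
  unfolding order_converges_def order_dominated_def decreases_to_def directed_set_def by blast

text \<open>Pairs with equal first component lie below each other, so this is a preorder and in
  general no partial order. In return, every tail contains a full copy \<open>{n} \<times> A\<close>
  of the set.\<close>

lemma directed_set_nat_times:
  assumes "A \<noteq> {}"
  shows "directed_set ((UNIV :: nat set) \<times> A)
    {(i, j). i \<in> UNIV \<times> A \<and> j \<in> UNIV \<times> A \<and> fst i \<le> fst j}"
proof -
  have "\<exists>k \<in> UNIV \<times> A. fst i \<le> fst k \<and> fst j \<le> fst k" if "i \<in> UNIV \<times> A" for i j :: "nat \<times> 'a"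
    \<comment> \<open>Any element of \<open>A\<close> could be the second component, as only the
      first ones are compared.\<close>
    using that by (intro bexI[of _ "(max (fst i) (fst j), snd i)"]) auto
  then show ?thesis
    using assms by (fastforce simp: directed_set_def preorder_on_def refl_on_def trans_def)
qed

text \<open>By homogeneity of \<open>p\<close>, the bound \<open>e\<close> gives a bound by
  \<open>e / (n + 1)\<close> at every pair \<open>(n, a)\<close>, uniformly in \<open>a\<close>; so
  a sequence in \<open>E\<close> dominates the net.\<close>

lemma (in lattice_normed_space) p_converges_inverse_Suc_scaleR:
  assumes A: "A \<noteq> {}" and e: "\<And>a. a \<in> A \<Longrightarrow> p a \<le> e"
  shows "p_converges p (UNIV \<times> A)
    {(i, j). i \<in> UNIV \<times> A \<and> j \<in> UNIV \<times> A \<and> fst i \<le> fst j}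
    (\<lambda>i. (1 / real (Suc (fst i))) *\<^sub>R snd i) 0" (is "p_converges p ?I ?r ?x 0")
proof -
  obtain a\<^sub>0 where a0: "a\<^sub>0 \<in> A" using A by blast
  \<comment> \<open>The sign of \<open>e\<close> comes from a point of \<open>A\<close>.\<close>
  have "0 \<le> e" using p_nonneg e[OF a0] by (rule order_trans)
  have le: "\<bar>p (?x i - 0) - 0\<bar> \<le> (1 / real (Suc n)) *\<^sub>R e" if "i \<in> ?I" "n \<le> fst i" for n i
  proof -
    have "\<bar>p (?x i - 0) - 0\<bar> = (1 / real (Suc (fst i))) *\<^sub>R p (snd i)"
      by (simp add: p_scaleR abs_of_nonneg p_nonneg scaleR_nonneg_nonneg)
    also have "\<dots> \<le> (1 / real (Suc n)) *\<^sub>R e"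
      using that e p_nonneg by (intro scaleR_mono) (auto simp: frac_le)
    finally show ?thesis .
  qed
  have "\<exists>i\<in>?I. \<forall>j\<in>?I. (i, j) \<in> ?r \<longrightarrow> \<bar>p (?x j - 0) - 0\<bar> \<le> (1 / real (Suc n)) *\<^sub>R e" for n
    using a0 le by (intro bexI[of _ "(n, a\<^sub>0)"]) auto
  then have "order_dominated UNIV {(m, n). m \<le> n} (\<lambda>n. (1 / real (Suc n)) *\<^sub>R e)
      ?I ?r (\<lambda>i. p (?x i - 0)) 0"
    using decreases_to_inverse_Suc[OF \<open>0 \<le> e\<close>] by (simp add: order_dominated_def)
  then show ?thesis
    unfolding p_converges_def by (rule order_convergesI)
qed

theorem proposition4:
  fixes p :: "'x::real_vector \<Rightarrow> 'e::archimedean_vector_lattice"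
    and m :: "'y::real_vector \<Rightarrow> 'f::archimedean_vector_lattice"
    and T :: "'x \<Rightarrow> 'y"
  assumes "lattice_normed_space p"
    and "lattice_normed_space m"
    and "linear T"
    and "p_continuous p m T"
  shows "p_bounded p m T"
  unfolding p_bounded_def
proof (intro allI impI)
  interpret P: lattice_normed_space p by fact
  interpret M: lattice_normed_space m by fact
  fix A assume "p_bounded_set p A"
  then obtain e where e: "\<And>a. a \<in> A \<Longrightarrow> p a \<le> e"
    by (auto simp: p_bounded_set_def)
  show "p_bounded_set m (T ` A)"
  \<comment> \<open>An empty \<open>A\<close> would leave the net without indices, so it is treated
    apart.\<close>
  proof (cases "A = {}")
    case True
    then show ?thesis by (simp add: p_bounded_set_def)
  next
    case False
    let ?I = "(UNIV :: nat set) \<times> A"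
    let ?r = "{(i, j). i \<in> ?I \<and> j \<in> ?I \<and> fst i \<le> fst j}"
    have "p_converges m ?I ?r (\<lambda>i. T ((1 / real (Suc (fst i))) *\<^sub>R snd i)) 0"
      using assms(4) directed_set_nat_times[OF False] P.p_converges_inverse_Suc_scaleR[OF False e]
      by (rule p_continuousD)
    then obtain i b where i: "i \<in> ?I"
      and b: "\<And>j. j \<in> ?I \<Longrightarrow> (i, j) \<in> ?r \<Longrightarrow>
        \<bar>m (T ((1 / real (Suc (fst j))) *\<^sub>R snd j) - 0) - 0\<bar> \<le> b"
      unfolding p_converges_def by (rule order_converges_eventually_bounded) blast
    \<comment> \<open>Undoing the scaling at the level where the bounded tail starts costs this
      factor.\<close>
    define c where "c = real (Suc (fst i))"
    have c: "c > 0" by (simp add: c_def)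
    have "m (T a) \<le> c *\<^sub>R b" if "a \<in> A" for a
    proof -
      have "(1 / c) *\<^sub>R m (T a) = m (T ((1 / c) *\<^sub>R a))"
        using c by (simp add: linear_scale[OF assms(3)] M.p_scaleR)
      also have "\<dots> \<le> b"
        \<comment> \<open>The pair \<open>(fst i, a)\<close> lies above \<open>i\<close> for every
          \<open>a\<close> in \<open>A\<close>, so one \<open>b\<close> serves them all.\<close>
        using b[of "(fst i, a)"] i that abs_ge_self order_trans by (fastforce simp: c_def)
      finally have "c *\<^sub>R ((1 / c) *\<^sub>R m (T a)) \<le> c *\<^sub>R b"
        using c by (intro scaleR_left_mono) auto
      then show ?thesis using c by simp
    qed
    then show ?thesis by (auto simp: p_bounded_set_def)
  qed
qed

end
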